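(* Let $G$ be a finite group and let $A$ be a subgroup of $\operatorname{Aut}(G)$. If $G$ is not cyclic, then $$0=\sum_{[H]_A \in \mathcal C_A(G)}\mu_A(H,G)\,\Bigl|\bigcup_{a\in A}H^a\Bigr|.$$
   Context: The Möbius function of a finite poset $P$ is the map $\mu_P:P\times P\to\mathbb Z$ with $\mu_P(x,y)=0$ unless $x\leq y$, $\mu_P(x,x)=1$, and $\sum_{x\leq z\leq y}\mu_P(x,z)=0$ for $x<y$. For a finite group $G$ and $A\leq \operatorname{Aut}(G)$, let $[H]_A=\{H^a\mid a\in A\}$ for $H\leq G$, and let $\mathcal C_A(G)$ be the set of all $[H]_A$, $H\le G$, partially ordered by: $[H]_A\leq [K]_A$ if $H^a\leq K$ for some $a\in A$. Let $\mu_A$ be the Möbius function of the poset $\mathcal C_A(G)$ and write $\mu_A(H,K)=\mu_A([H]_A,[K]_A)$. *)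

theory Defs
  imports "HOL-Algebra.Elementary_Groups" "HOL-Algebra.Bij"
begin

section \<open>The Moebius function of a finite poset\<close>

definition is_mobius :: "'a set \<Rightarrow> 'a rel \<Rightarrow> ('a \<Rightarrow> 'a \<Rightarrow> int) \<Rightarrow> bool" where
  "is_mobius P r m \<longleftrightarrow>
     (\<forall>x y. (x, y) \<notin> r \<longrightarrow> m x y = 0) \<and>
     (\<forall>x\<in>P. m x x = 1) \<and>
     (\<forall>x y. (x, y) \<in> r \<and> x \<noteq> y \<longrightarrow> (\<Sum>z | (x, z) \<in> r \<and> (z, y) \<in> r. m x z) = 0)"

text \<open>
  Meaningful when \<open>P\<close> is finite and \<open>r\<close> is a partial order on \<open>P\<close>, see \<open>mobius\<close> below.
  Then \<open>r\<close> is a subset of \<open>P \<times> P\<close>, so the function is \<open>0\<close> on arguments outside \<open>P\<close>.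
\<close>

definition mobius :: "'a set \<Rightarrow> 'a rel \<Rightarrow> 'a \<Rightarrow> 'a \<Rightarrow> int" where
  "mobius P r = (THE m. is_mobius P r m)"

lemma finite_interval:
  assumes "finite P" "partial_order_on P r"
  shows "finite {z. (x, z) \<in> r \<and> (z, y) \<in> r}"
  by (rule finite_subset[OF _ assms(1)]) (use partial_order_onD(4)[OF assms(2)] in blast)

lemma wf_partial_order:
  assumes "finite P" "partial_order_on P r"
  shows "wf (r - Id)"
proof -
  have "finite r"
    by (rule finite_subset[OF partial_order_onD(4)[OF assms(2)]]) (simp add: assms(1))
  then show ?thesis
    using assms(2) by (rule partial_order_on_well_order_on)
qed

lemma interval_split:
  assumes "partial_order_on P r" "(x, y) \<in> r"
  shows "{z. (x, z) \<in> r \<and> (z, y) \<in> r} = insert y {z. (x, z) \<in> r \<and> (z, y) \<in> r - Id}"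
  using assms partial_order_onD[OF assms(1)] by (auto simp: refl_on_def)

lemma sum_interval_split:
  fixes f :: "'a \<Rightarrow> int"
  assumes "finite P" "partial_order_on P r" "(x, y) \<in> r"
  shows "(\<Sum>z | (x, z) \<in> r \<and> (z, y) \<in> r. f z) = f y + (\<Sum>z | (x, z) \<in> r \<and> (z, y) \<in> r - Id. f z)"
proof -
  have "finite {z. (x, z) \<in> r \<and> (z, y) \<in> r - Id}"
    by (rule finite_subset[OF _ finite_interval[OF assms(1,2)]]) auto
  then show ?thesis
    unfolding interval_split[OF assms(2,3)] by (subst sum.insert) auto
qed

lemma is_mobius_unique:
  assumes "finite P" "partial_order_on P r" "is_mobius P r m" "is_mobius P r m'"
  shows "m = m'"
proof (rule ext, rule ext)
  fix x y
  show "m x y = m' x y"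
  proof (induction y rule: wf_induct_rule[OF wf_partial_order[OF assms(1,2)]])
    case (1 y)
    consider "(x, y) \<notin> r" | "(x, y) \<in> r" "x = y" | "(x, y) \<in> r" "x \<noteq> y" by blast
    then show ?case
    proof cases
      case 3
      have "m x y + (\<Sum>z | (x, z) \<in> r \<and> (z, y) \<in> r - Id. m x z) = 0"
           "m' x y + (\<Sum>z | (x, z) \<in> r \<and> (z, y) \<in> r - Id. m' x z) = 0"
        using 3 assms(3,4) sum_interval_split[OF assms(1,2) 3(1), of "m x"]
          sum_interval_split[OF assms(1,2) 3(1), of "m' x"]
        by (auto simp: is_mobius_def)
      moreover have "(\<Sum>z | (x, z) \<in> r \<and> (z, y) \<in> r - Id. m x z) =
          (\<Sum>z | (x, z) \<in> r \<and> (z, y) \<in> r - Id. m' x z)"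
        by (rule sum.cong) (use 1 in auto)
      ultimately show ?thesis by linarith
    qed (use assms(3,4) partial_order_onD(4)[OF assms(2)] in \<open>auto simp: is_mobius_def\<close>)
  qed
qed

lemma is_mobius_exists:
  assumes "finite P" "partial_order_on P r"
  shows "\<exists>m. is_mobius P r m"
proof -
  define F where "F x f y =
      (if (x, y) \<notin> r then 0 else if x = y then 1
       else - (\<Sum>z | (x, z) \<in> r \<and> (z, y) \<in> r - Id. f z))" for x :: 'a and f :: "'a \<Rightarrow> int" and y
  define m where "m x = wfrec (r - Id) (F x)" for x
  have m: "m x y = F x (m x) y" for x y
  proof -
    have "m x y = F x (cut (m x) (r - Id) y) y"
      unfolding m_def by (rule wfrec[OF wf_partial_order[OF assms]])
    also have "\<dots> = F x (m x) y"
      unfolding F_def by (auto simp: cut_apply intro!: sum.cong)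
    finally show ?thesis .
  qed
  have "is_mobius P r m"
    unfolding is_mobius_def
  proof (intro conjI allI impI ballI)
    fix x y assume "(x, y) \<notin> r"
    then show "m x y = 0" by (simp add: m[of x y] F_def)
  next
    fix x assume "x \<in> P"
    then have "(x, x) \<in> r"
      using partial_order_onD(1)[OF assms(2)] by (auto simp: refl_on_def)
    then show "m x x = 1" by (simp add: m[of x x] F_def)
  next
    fix x y assume xy: "(x, y) \<in> r \<and> x \<noteq> y"
    then have "m x y = - (\<Sum>z | (x, z) \<in> r \<and> (z, y) \<in> r - Id. m x z)"
      by (simp add: m[of x y] F_def)
    then show "(\<Sum>z | (x, z) \<in> r \<and> (z, y) \<in> r. m x z) = 0"
      using xy sum_interval_split[OF assms, of x y "m x"] by simp
  qed
  then show ?thesis by blast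
qed

lemma is_mobius_mobius:
  assumes "finite P" "partial_order_on P r"
  shows "is_mobius P r (mobius P r)"
  unfolding mobius_def
  using is_mobius_exists[OF assms] is_mobius_unique[OF assms] by (metis theI)


section \<open>The poset of automorphism classes of subgroups\<close>

text \<open>
  Automorphisms act on the right in exponent notation: \<open>H\<close> to the power \<open>a\<close> is the image \<open>a ` H\<close>.
\<close>

definition aut_class :: "('a \<Rightarrow> 'a) set \<Rightarrow> 'a set \<Rightarrow> 'a set set" where
  "aut_class A H = {a ` H | a. a \<in> A}"

definition subgroup_classes :: "('a, 'b) monoid_scheme \<Rightarrow> ('a \<Rightarrow> 'a) set \<Rightarrow> 'a set set set" where
  "subgroup_classes G A = {aut_class A H | H. subgroup H G}"

definition subgroup_class_order :: "('a, 'b) monoid_scheme \<Rightarrow> ('a \<Rightarrow> 'a) set \<Rightarrow> 'a set set rel" where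
  "subgroup_class_order G A =
     {(aut_class A H, aut_class A K) | H K.
        subgroup H G \<and> subgroup K G \<and> (\<exists>a\<in>A. a ` H \<subseteq> K)}"

abbreviation class_mobius ::
    "('a, 'b) monoid_scheme \<Rightarrow> ('a \<Rightarrow> 'a) set \<Rightarrow> 'a set set \<Rightarrow> 'a set set \<Rightarrow> int" where
  "class_mobius G A \<equiv> mobius (subgroup_classes G A) (subgroup_class_order G A)"

context group
begin

context
  fixes A
  assumes A: "subgroup A (AutoGroup G)"
begin

lemma aut_id: obtains e where "e \<in> A" "\<And>H. subgroup H G \<Longrightarrow> e ` H = H"
proof
  show "(\<lambda>x\<in>carrier G. x) \<in> A"
    using subgroup.one_closed[OF A] by (simp add: AutoGroup_def BijGroup_def)
  show "(\<lambda>x\<in>carrier G. x) ` H = H" if "subgroup H G" for H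
    using subgroup.subset[OF that] by auto
qed

lemma aut_in_auto: "a \<in> A \<Longrightarrow> a \<in> auto G"
  using subgroup.subset[OF A] by (auto simp: AutoGroup_def)

lemma aut_comp:
  assumes "a \<in> A" "b \<in> A"
  obtains c where "c \<in> A" "\<And>H. H \<subseteq> carrier G \<Longrightarrow> c ` H = a ` b ` H"
proof
  show "compose (carrier G) a b \<in> A"
    using subgroup.m_closed[OF A assms] assms[THEN aut_in_auto]
    by (simp add: AutoGroup_def BijGroup_def auto_def)
  show "compose (carrier G) a b ` H = a ` b ` H" if "H \<subseteq> carrier G" for H
    unfolding image_image by (rule image_cong) (use that in \<open>auto simp: compose_def\<close>)
qed

lemma aut_inv:
  assumes "a \<in> A"
  obtains b where "b \<in> A" "\<And>H. H \<subseteq> carrier G \<Longrightarrow> b ` a ` H = H"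
proof
  interpret AG: group "AutoGroup G" by (rule AutoGroup)
  let ?b = "inv\<^bsub>AutoGroup G\<^esub> a"
  show bA: "?b \<in> A" by (rule subgroup.m_inv_closed[OF A assms])
  have "?b \<otimes>\<^bsub>AutoGroup G\<^esub> a = \<one>\<^bsub>AutoGroup G\<^esub>"
    by (rule AG.l_inv) (use subgroup.subset[OF A] assms in auto)
  then have "compose (carrier G) ?b a = (\<lambda>x\<in>carrier G. x)"
    using aut_in_auto[OF assms] aut_in_auto[OF bA]
    by (simp add: AutoGroup_def BijGroup_def auto_def)
  then have "?b (a x) = x" if "x \<in> carrier G" for x
    using that by (metis compose_eq restrict_apply')
  then show "?b ` a ` H = H" if "H \<subseteq> carrier G" for H
    using that by (simp add: image_image subset_iff)
qed

lemma aut_class_eq_iff: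
  assumes "subgroup H G" "subgroup K G"
  shows "aut_class A H = aut_class A K \<longleftrightarrow> (\<exists>a\<in>A. a ` H = K)"
proof
  assume eq: "aut_class A H = aut_class A K"
  obtain e where "e \<in> A" "e ` K = K" using aut_id assms by metis
  then have "K \<in> aut_class A K" by (auto simp: aut_class_def)
  then show "\<exists>a\<in>A. a ` H = K" unfolding eq[symmetric] by (auto simp: aut_class_def)
next
  assume "\<exists>a\<in>A. a ` H = K"
  then obtain a where a: "a \<in> A" "a ` H = K" by blast
  obtain b where b: "b \<in> A" "b ` K = H"
    using aut_inv[OF a(1)] a(2) subgroup.subset[OF assms(1)] by metis
  have "c ` H \<in> aut_class A K" if "c \<in> A" for c
  proof -
    obtain d where "d \<in> A" "d ` K = c ` b ` K"
      using aut_comp[OF \<open>c \<in> A\<close> b(1)] subgroup.subset[OF assms(2)] by metis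
    then show ?thesis using b(2) unfolding aut_class_def by (metis (mono_tags, lifting) mem_Collect_eq)
  qed
  moreover have "c ` K \<in> aut_class A H" if "c \<in> A" for c
  proof -
    obtain d where "d \<in> A" "d ` H = c ` a ` H"
      using aut_comp[OF \<open>c \<in> A\<close> a(1)] subgroup.subset[OF assms(1)] by metis
    then show ?thesis using a(2) unfolding aut_class_def by (metis (mono_tags, lifting) mem_Collect_eq)
  qed
  ultimately show "aut_class A H = aut_class A K"
    by (auto simp: aut_class_def)
qed

lemma subgroup_class_order_iff:
  assumes "subgroup H G" "subgroup K G"
  shows "(aut_class A H, aut_class A K) \<in> subgroup_class_order G A \<longleftrightarrow> (\<exists>a\<in>A. a ` H \<subseteq> K)"
proof
  assume "(aut_class A H, aut_class A K) \<in> subgroup_class_order G A"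
  then obtain H' K' a where *: "subgroup H' G" "subgroup K' G" "a \<in> A" "a ` H' \<subseteq> K'"
      "aut_class A H = aut_class A H'" "aut_class A K' = aut_class A K"
    by (auto simp: subgroup_class_order_def)
  obtain b c where bc: "b \<in> A" "b ` H = H'" "c \<in> A" "c ` K' = K"
    using * assms aut_class_eq_iff by meson
  obtain d where d: "d \<in> A" "d ` H = a ` b ` H"
    using aut_comp[OF \<open>a \<in> A\<close> bc(1)] subgroup.subset[OF assms(1)] by metis
  obtain f where "f \<in> A" "f ` H = c ` d ` H"
    using aut_comp[OF bc(3) d(1)] subgroup.subset[OF assms(1)] by metis
  moreover have "c ` d ` H \<subseteq> K"
    using *(4) bc(2,4) d(2) by blast
  ultimately show "\<exists>a\<in>A. a ` H \<subseteq> K" by metis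
qed (use assms in \<open>auto simp: subgroup_class_order_def\<close>)

lemma finite_subgroup_classes:
  assumes "finite (carrier G)"
  shows "finite (subgroup_classes G A)"
proof -
  have "subgroup_classes G A \<subseteq> aut_class A ` Pow (carrier G)"
    by (auto simp: subgroup_classes_def dest: subgroup.subset)
  then show ?thesis by (rule finite_subset) (simp add: assms)
qed

lemma partial_order_on_subgroup_classes:
  assumes fin: "finite (carrier G)"
  shows "partial_order_on (subgroup_classes G A) (subgroup_class_order G A)"
  unfolding partial_order_on_def preorder_on_def
proof (intro conjI)
  show "subgroup_class_order G A \<subseteq> subgroup_classes G A \<times> subgroup_classes G A"
    by (auto simp: subgroup_class_order_def subgroup_classes_def)
  show "refl_on (subgroup_classes G A) (subgroup_class_order G A)"
  proof (rule refl_onI)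
    fix X assume "X \<in> subgroup_classes G A"
    then obtain H where H: "subgroup H G" "X = aut_class A H"
      by (auto simp: subgroup_classes_def)
    obtain e where "e \<in> A" "e ` H = H" using aut_id H(1) by metis
    then show "(X, X) \<in> subgroup_class_order G A"
      unfolding H(2) subgroup_class_order_iff[OF H(1) H(1)] by blast
  qed
  show "trans (subgroup_class_order G A)"
  proof (rule transI)
    fix X Y Z
    assume "(X, Y) \<in> subgroup_class_order G A" and YZ: "(Y, Z) \<in> subgroup_class_order G A"
    then obtain H K a where 1: "subgroup H G" "subgroup K G" "X = aut_class A H"
        "Y = aut_class A K" "a \<in> A" "a ` H \<subseteq> K"
      by (auto simp: subgroup_class_order_def)
    from YZ obtain L where 2: "subgroup L G" "Z = aut_class A L"
      by (auto simp: subgroup_class_order_def)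
    obtain b where b: "b \<in> A" "b ` K \<subseteq> L"
      using YZ subgroup_class_order_iff[OF 1(2) 2(1)] unfolding 1(4) 2(2) by blast
    obtain c where "c \<in> A" "c ` H = b ` a ` H"
      using aut_comp[OF b(1) 1(5)] subgroup.subset[OF 1(1)] by metis
    moreover have "b ` a ` H \<subseteq> L" using 1(6) b(2) by blast
    ultimately show "(X, Z) \<in> subgroup_class_order G A"
      unfolding 1(3) 2(2) subgroup_class_order_iff[OF 1(1) 2(1)] by metis
  qed
  show "antisym (subgroup_class_order G A)"
  proof (rule antisymI)
    fix X Y
    assume "(X, Y) \<in> subgroup_class_order G A" and YX: "(Y, X) \<in> subgroup_class_order G A"
    then obtain H K a where 1: "subgroup H G" "subgroup K G" "X = aut_class A H"
        "Y = aut_class A K" "a \<in> A" "a ` H \<subseteq> K"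
      by (auto simp: subgroup_class_order_def)
    obtain b where b: "b \<in> A" "b ` K \<subseteq> H"
      using YX subgroup_class_order_iff[OF 1(2) 1(1)] unfolding 1(3,4) by blast
    have card_image_aut: "card (c ` L) = card L" if "c \<in> A" "subgroup L G" for c L
      by (rule card_image, rule inj_on_subset[OF _ subgroup.subset[OF that(2)]])
         (use aut_in_auto[OF that(1)] in \<open>auto simp: auto_def Bij_def bij_betw_def\<close>)
    have finH: "finite H" and finK: "finite K"
      using 1(1,2) fin by (auto dest: subgroup.subset intro: finite_subset)
    have "card K \<le> card (a ` H)"
      using card_image_aut[OF b(1) 1(2)] card_image_aut[OF 1(5) 1(1)] card_mono[OF finH b(2)]
      by simp
    then have "a ` H = K" using card_seteq[OF finK 1(6)] by blast
    then show "X = Y"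
      unfolding 1(3,4) using aut_class_eq_iff[OF 1(1,2)] 1(5) by blast
  qed
qed

lemma is_mobius_class_mobius:
  assumes "finite (carrier G)"
  shows "is_mobius (subgroup_classes G A) (subgroup_class_order G A) (class_mobius G A)"
  by (rule is_mobius_mobius[OF finite_subgroup_classes[OF assms]
        partial_order_on_subgroup_classes[OF assms]])

end

end

end

theory Submission
  imports Defs
begin

text \<open>
  An element \<open>x\<close> lies in some image of \<open>H\<close> iff the class of \<open>\<langle>x\<rangle>\<close> is below the class of \<open>H\<close>.
  Counting pairs \<open>(C, x)\<close> with \<open>x \<in> \<Union>C\<close> therefore turns the sum into the sum over \<open>x\<close> of
  \<open>\<mu>(C, [G])\<close> taken over the interval from \<open>[\<langle>x\<rangle>]\<close> to \<open>[G]\<close>. Since \<open>G\<close> is not cyclic, the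
  interval is never a single point, so each inner sum vanishes by the dual recursion of the
  Moebius function.
\<close>

text \<open>Joins normalisation and recursion into one Kronecker delta: by antisymmetry the interval
  is a single point when \<open>x = y\<close>.\<close>

lemma is_mobius_diag:
  assumes "is_mobius P r m" "partial_order_on P r" "(x, y) \<in> r"
  shows "(\<Sum>z | (x, z) \<in> r \<and> (z, y) \<in> r. m x z) = (if x = y then 1 else 0)"
proof (cases "x = y")
  case True
  have "x \<in> P" using partial_order_onD(4)[OF assms(2)] assms(3) by blast
  moreover have "{z. (x, z) \<in> r \<and> (z, x) \<in> r} = {x}"
    using partial_order_onD(3)[OF assms(2)] assms(3) True by (auto dest: antisymD)
  ultimately show ?thesis using assms(1) True by (simp add: is_mobius_def)
qed (use assms in \<open>auto simp: is_mobius_def\<close>)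

text \<open>
  In the incidence algebra, the Moebius function of the opposite order is a right inverse of zeta,
  hence equal to the left inverse.
\<close>

lemma is_mobius_converse_eq:
  assumes fin: "finite P" and po: "partial_order_on P r"
    and m: "is_mobius P r m" and n: "is_mobius P (r\<inverse>) n" and xy: "(x, y) \<in> r"
  shows "m x y = n y x"
proof -
  have po': "partial_order_on P (r\<inverse>)" using po by simp
  define I where "I = {z. (x, z) \<in> r \<and> (z, y) \<in> r}"
  have finI: "finite I" unfolding I_def by (rule finite_interval[OF fin po])
  have tr: "trans r" by (rule partial_order_onD(2)[OF po])
  have I: "x \<in> I" "y \<in> I"
    using partial_order_onD(1,4)[OF po] xy by (auto simp: I_def refl_on_def)
  \<comment> \<open>By transitivity \<open>I\<close> contains the whole interval from
    \<open>x\<close> to \<open>w\<close>, so restricting to \<open>I\<close> drops no term.\<close>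
  have below: "(\<Sum>z\<in>{z \<in> I. (z, w) \<in> r}. m x z) = (if x = w then 1 else 0)" if "w \<in> I" for w
  proof -
    have "{z \<in> I. (z, w) \<in> r} = {z. (x, z) \<in> r \<and> (z, w) \<in> r}"
      using that tr by (auto simp: I_def dest: transD)
    then show ?thesis using is_mobius_diag[OF m po, of x w] that by (simp add: I_def)
  qed
  have above: "(\<Sum>w\<in>{w \<in> I. (z, w) \<in> r}. n y w) = (if y = z then 1 else 0)" if "z \<in> I" for z
  proof -
    have "{w \<in> I. (z, w) \<in> r} = {w. (y, w) \<in> r\<inverse> \<and> (w, z) \<in> r\<inverse>}"
      using that tr by (auto simp: I_def dest: transD)
    then show ?thesis using is_mobius_diag[OF n po', of y z] that by (simp add: I_def)
  qed
  \<comment> \<open>The sum of \<open>m x z * n y w\<close> over pairs \<open>z\<close> below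
    \<open>w\<close> in \<open>I\<close> is evaluated twice: summing over \<open>z\<close> first
    leaves \<open>n y x\<close>, over \<open>w\<close> first \<open>m x y\<close>.\<close>
  have "n y x = (\<Sum>w\<in>I. if x = w then n y w else 0)"
    using finI I by simp
  also have "\<dots> = (\<Sum>w\<in>I. \<Sum>z\<in>{z \<in> I. (z, w) \<in> r}. m x z * n y w)"
    by (rule sum.cong) (simp_all add: below flip: sum_distrib_right)
  also have "\<dots> = (\<Sum>z\<in>I. \<Sum>w\<in>{w \<in> I. (z, w) \<in> r}. m x z * n y w)"
    by (rule sum.swap_restrict[OF finI finI])
  also have "\<dots> = (\<Sum>z\<in>I. if y = z then m x z else 0)"
    by (rule sum.cong) (simp_all add: above flip: sum_distrib_left)
  also have "\<dots> = m x y"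
    using finI I by simp
  finally show ?thesis by simp
qed

text \<open>The defining recursion fixes the lower argument, whereas here the upper one is fixed.
  Reversing the order exchanges the two roles, and on comparable pairs the Moebius function
  \<open>n\<close> of the reversed order is \<open>m\<close> with its arguments swapped.\<close>

lemma is_mobius_sum_dual:
  assumes fin: "finite P" and po: "partial_order_on P r" and m: "is_mobius P r m"
    and xy: "(x, y) \<in> r" "x \<noteq> y"
  shows "(\<Sum>z | (x, z) \<in> r \<and> (z, y) \<in> r. m z y) = 0"
proof -
  have po': "partial_order_on P (r\<inverse>)" using po by simp
  obtain n where n: "is_mobius P (r\<inverse>) n" using is_mobius_exists[OF fin po'] by blast
  have "(\<Sum>z | (x, z) \<in> r \<and> (z, y) \<in> r. m z y) =
      (\<Sum>z | (y, z) \<in> r\<inverse> \<and> (z, x) \<in> r\<inverse>. n y z)"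
    by (rule sum.cong) (auto intro: is_mobius_converse_eq[OF fin po m n])
  also have "\<dots> = 0" using is_mobius_diag[OF n po', of y x] xy by simp
  finally show ?thesis .
qed

context group
begin

context
  fixes A
  assumes A: "subgroup A (AutoGroup G)"
begin

lemma subgroup_aut_image:
  assumes "a \<in> A" "subgroup H G"
  shows "subgroup (a ` H) G"
proof -
  have "group_hom G G a"
    using aut_in_auto[OF A assms(1)]
    by (intro group_hom.intro group_hom_axioms.intro is_group) (auto simp: auto_def)
  then show ?thesis using assms(2) by (rule group_hom.subgroup_img_is_subgroup)
qed

text \<open>The union moves \<open>H\<close> by automorphisms while the order moves the lower
  subgroup; inverses in \<open>A\<close> pass from one to the other.\<close>

lemma mem_Union_aut_class_iff:
  assumes H: "subgroup H G" and x: "x \<in> carrier G"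
  shows "x \<in> \<Union>(aut_class A H) \<longleftrightarrow>
    (aut_class A (generate G {x}), aut_class A H) \<in> subgroup_class_order G A"
proof -
  have gen: "subgroup (generate G {x}) G" using x by (simp add: generate_is_subgroup)
  have "x \<in> \<Union>(aut_class A H) \<longleftrightarrow> (\<exists>b\<in>A. b ` generate G {x} \<subseteq> H)"
  proof
    assume "x \<in> \<Union>(aut_class A H)"
    then obtain a where a: "a \<in> A" "x \<in> a ` H" by (auto simp: aut_class_def)
    obtain b where b: "b \<in> A" "b ` a ` H = H"
      using aut_inv[OF A a(1)] subgroup.subset[OF H] by metis
    have "generate G {x} \<subseteq> a ` H"
      using generate_subgroup_incl[OF _ subgroup_aut_image[OF a(1) H]] a(2) by simp
    then show "\<exists>b\<in>A. b ` generate G {x} \<subseteq> H" using b by blast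
  next
    assume "\<exists>b\<in>A. b ` generate G {x} \<subseteq> H"
    then obtain b where b: "b \<in> A" "b ` generate G {x} \<subseteq> H" by blast
    \<comment> \<open>\<open>c\<close> undoes \<open>b\<close>; applied to the inclusion in
      \<open>H\<close>, it puts \<open>x\<close> into the image of \<open>H\<close> under
      \<open>c\<close>.\<close>
    obtain c where c: "c \<in> A" "c ` b ` generate G {x} = generate G {x}"
      using aut_inv[OF A b(1)] subgroup.subset[OF gen] by metis
    have "x \<in> c ` H" using b(2) c(2) generate.incl[of x "{x}"] by blast
    then show "x \<in> \<Union>(aut_class A H)" using c(1) by (auto simp: aut_class_def)
  qed
  then show ?thesis using subgroup_class_order_iff[OF A gen H] by simp
qed

text \<open>Automorphisms map the whole group onto itself, so its class has no other member; equal
  classes would make \<open>x\<close> a generator.\<close>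

lemma aut_class_generate_neq_carrier:
  assumes "\<not> cyclic_group G" and x: "x \<in> carrier G"
  shows "aut_class A (generate G {x}) \<noteq> aut_class A (carrier G)"
proof
  have gen: "subgroup (generate G {x}) G" using x by (simp add: generate_is_subgroup)
  assume "aut_class A (generate G {x}) = aut_class A (carrier G)"
  then obtain a where a: "a \<in> A" "a ` carrier G = generate G {x}"
    using aut_class_eq_iff[OF A subgroup_self gen] by metis
  moreover have "a ` carrier G = carrier G"
    using aut_in_auto[OF A a(1)] by (auto simp: auto_def Bij_def bij_betw_def)
  ultimately have "carrier G = range (\<lambda>n::int. x [^] n)"
    using generate_pow[OF x] by auto
  then show False using assms cyclic_group by blast
qed

lemma sum_class_mobius_card_Union:
  assumes fin: "finite (carrier G)" and ncyc: "\<not> cyclic_group G"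
  shows "(\<Sum>C\<in>subgroup_classes G A.
    class_mobius G A C (aut_class A (carrier G)) * int (card (\<Union>C))) = 0"
proof -
  let ?P = "subgroup_classes G A" and ?r = "subgroup_class_order G A"
  let ?T = "aut_class A (carrier G)"
  note finP = finite_subgroup_classes[OF A fin]
  note po = partial_order_on_subgroup_classes[OF A fin]
  have Union: "\<Union>C \<subseteq> carrier G" if "C \<in> ?P" for C
    using that subgroup.subset[OF subgroup_aut_image]
    by (fastforce simp: subgroup_classes_def aut_class_def)
  \<comment> \<open>\<open>?T\<close> is the greatest class, so the classes above a given one form
    an interval ending at \<open>?T\<close>.\<close>
  have top: "(C, ?T) \<in> ?r" if "C \<in> ?P" for C
  proof -
    obtain H where H: "subgroup H G" "C = aut_class A H"
      using \<open>C \<in> ?P\<close> by (auto simp: subgroup_classes_def)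
    obtain e where "e \<in> A" "e ` H = H" using aut_id[OF A] H(1) by metis
    then show ?thesis
      using subgroup_class_order_iff[OF A H(1) subgroup_self] subgroup.subset[OF H(1)] H(2) by metis
  qed
  have mem: "x \<in> \<Union>C \<longleftrightarrow> (aut_class A (generate G {x}), C) \<in> ?r"
    if "C \<in> ?P" "x \<in> carrier G" for C x
    using that mem_Union_aut_class_iff by (auto simp: subgroup_classes_def)
  \<comment> \<open>Each cardinality is written as a count over \<open>carrier G\<close> filtered by
    membership, so that the two summations can be interchanged.\<close>
  have "(\<Sum>C\<in>?P. class_mobius G A C ?T * int (card (\<Union>C))) =
      (\<Sum>C\<in>?P. \<Sum>x\<in>{x \<in> carrier G. x \<in> \<Union>C}. class_mobius G A C ?T)"
  proof (rule sum.cong)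
    fix C assume "C \<in> ?P"
    then have "{x \<in> carrier G. x \<in> \<Union>C} = \<Union>C" using Union by blast
    then show "class_mobius G A C ?T * int (card (\<Union>C)) =
        (\<Sum>x\<in>{x \<in> carrier G. x \<in> \<Union>C}. class_mobius G A C ?T)"
      by simp
  qed simp
  also have "\<dots> = (\<Sum>x\<in>carrier G. \<Sum>C\<in>{C \<in> ?P. x \<in> \<Union>C}. class_mobius G A C ?T)"
    by (rule sum.swap_restrict[OF finP fin])
  also have "\<dots> = (\<Sum>x\<in>carrier G. 0)"
  proof (rule sum.cong)
    fix x assume x: "x \<in> carrier G"
    let ?X = "aut_class A (generate G {x})"
    have "?X \<in> ?P"
      using x generate_is_subgroup[of "{x}"] by (auto simp: subgroup_classes_def)
    moreover have "{C \<in> ?P. x \<in> \<Union>C} = {C. (?X, C) \<in> ?r \<and> (C, ?T) \<in> ?r}"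
    proof -
      have "{C \<in> ?P. x \<in> \<Union>C} = {C \<in> ?P. (?X, C) \<in> ?r}"
        by (rule Collect_cong) (use mem[OF _ x] in metis)
      also have "\<dots> = {C. (?X, C) \<in> ?r \<and> (C, ?T) \<in> ?r}"
        using top partial_order_onD(4)[OF po] by blast
      finally show ?thesis .
    qed
    ultimately show "(\<Sum>C\<in>{C \<in> ?P. x \<in> \<Union>C}. class_mobius G A C ?T) = 0"
      using is_mobius_sum_dual[OF finP po is_mobius_class_mobius[OF A fin] top
          aut_class_generate_neq_carrier[OF ncyc x]]
      by simp
  qed simp
  finally show ?thesis by simp
qed

end

end

theorem corollary3:
  fixes G :: "('a, 'b) monoid_scheme" and A :: "('a \<Rightarrow> 'a) set"
  assumes "group G" and "finite (carrier G)"
    and "subgroup A (AutoGroup G)"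
    and "\<not> cyclic_group G"
  shows "0 = (\<Sum>C\<in>subgroup_classes G A.
                class_mobius G A C (aut_class A (carrier G)) * int (card (\<Union>C)))"
  using group.sum_class_mobius_card_Union[OF assms(1,3,2,4)] by simp

end
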